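(* Let $\mathbf v$ be a complementary symmetric Rote sequence. Then every non-empty prefix $x$ of $\mathbf v$ has exactly three distinct return words in $\mathbf v$.
   Context: A complementary symmetric Rote sequence is a sequence $\mathbf v\in\{0,1\}^{\mathbb N}$ with factor complexity $\mathcal C(n)=2n$ for all $n\ge1$ (number of distinct factors of length $n$) whose set of factors is closed under the exchange of letters $0\leftrightarrow1$. For a prefix $x$ of a sequence $\mathbf v=v_0v_1\cdots$, if $i<j$ are two consecutive occurrences of $x$ in $\mathbf v$ (indices where $x$ starts), the word $v_iv_{i+1}\cdots v_{j-1}$ is a return word to $x$ in $\mathbf v$. *)

theory Defs
  imports "HOL-Library.Omega_Words_Fun"
begin

text \<open>
  A sequence over \<open>'a\<close> is an \<open>'a word\<close> of Omega_Words_Fun, that is, a function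
  \<open>nat \<Rightarrow> 'a\<close>; \<open>v [i \<rightarrow> j]\<close> is the finite word \<open>v i, \<dots>, v (j - 1)\<close>.
  Occurrences are indexed from 0.
\<close>

definition occurs_at :: "'a word \<Rightarrow> 'a list \<Rightarrow> nat \<Rightarrow> bool" where
  "occurs_at v w i \<longleftrightarrow> v [i \<rightarrow> i + length w] = w"

definition factors :: "'a word \<Rightarrow> 'a list set" where
  "factors v = {w. \<exists>i. occurs_at v w i}"

definition factor_complexity :: "'a word \<Rightarrow> nat \<Rightarrow> nat" where
  "factor_complexity v n = card {w \<in> factors v. length w = n}"

definition exchange :: "nat \<Rightarrow> nat" where
  "exchange a = (if a = 0 then 1 else if a = 1 then 0 else a)"

definition cs_Rote :: "nat word \<Rightarrow> bool" where
  "cs_Rote v \<longleftrightarrow>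
     range v \<subseteq> {0, 1} \<and>
     (\<forall>n\<ge>1. factor_complexity v n = 2 * n) \<and>
     (\<forall>w\<in>factors v. map exchange w \<in> factors v)"

definition consecutive_occurrences :: "'a word \<Rightarrow> 'a list \<Rightarrow> nat \<Rightarrow> nat \<Rightarrow> bool" where
  "consecutive_occurrences v x i j \<longleftrightarrow>
     i < j \<and> occurs_at v x i \<and> occurs_at v x j \<and> (\<forall>k. i < k \<and> k < j \<longrightarrow> \<not> occurs_at v x k)"

definition return_words :: "'a word \<Rightarrow> 'a list \<Rightarrow> 'a list set" where
  "return_words v x = {v [i \<rightarrow> j] | i j. consecutive_occurrences v x i j}"

end

theory Submission
  imports Defs
begin

text \<open>
  Extending a prefix \<open>x\<close> letter by letter to the right until \<open>x\<close> reappears gives a binary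
  tree whose leaves are the words \<open>r @ x\<close> with \<open>r\<close> a return word, so the number of return words is
  one plus the number of branching nodes, that is, of right special factors that start with \<open>x\<close>
  and contain it only once. Complexity \<open>2n\<close> means that there are exactly two right special factors
  of each length \<open>n \<ge> 1\<close>, and they are exchanged by \<open>0 \<leftrightarrow> 1\<close>. As \<open>v\<close> is recurrent and not
  eventually periodic, every factor is a prefix of a right special one; hence some right special
  factor \<open>q\<close> contains both \<open>x\<close> and its complement. The branching nodes are then the suffixes of
  \<open>q\<close> and of the complement of \<open>q\<close> that start at the last occurrence of \<open>x\<close>.
\<close>

section \<open>Occurrences and factors\<close>

lemma occurs_at_iff_nth: "occurs_at v w i \<longleftrightarrow> (\<forall>k<length w. v (i + k) = w ! k)"
  unfolding occurs_at_def list_eq_iff_nth_eq[of "v [i \<rightarrow> i + length w]" w] by simp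

lemma occurs_at_append:
  "occurs_at v (a @ b) i \<longleftrightarrow> occurs_at v a i \<and> occurs_at v b (i + length a)"
proof -
  have "v [i \<rightarrow> i + length (a @ b)]
    = v [i \<rightarrow> i + length a] @ v [i + length a \<rightarrow> i + length a + length b]"
    using upt_add_eq_append[of i "i + length a" "length b"]
    by (simp add: subsequence_def add.assoc)
  then show ?thesis by (simp add: occurs_at_def)
qed

lemma occurs_at_Nil [simp]: "occurs_at v [] i"
  by (simp add: occurs_at_iff_nth)

lemma occurs_at_singleton: "occurs_at v [c] i \<longleftrightarrow> v i = c"
  by (simp add: occurs_at_iff_nth)

lemma occurs_at_subsequence [simp]: "occurs_at v (v [i \<rightarrow> j]) i"
  by (simp add: occurs_at_iff_nth)

lemma occurs_at_unique:
  "occurs_at v a i \<Longrightarrow> occurs_at v b i \<Longrightarrow> length a = length b \<Longrightarrow> a = b"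
  unfolding occurs_at_def by metis

text \<open>Passes from positions in \<open>v\<close> to a factorization of the word
  \<open>z\<close>, the form in which \<open>single_occ\<close> and \<open>complete_returns\<close>
  speak of inner occurrences.\<close>

lemma occurs_at_inside:
  assumes "occurs_at v z i" "occurs_at v w (i + k)" "k + length w \<le> length z"
  obtains a b where "z = a @ w @ b" "length a = k"
proof
  define u where "u = take (length w) (drop k z)"
  have z: "z = take k z @ u @ drop (length w) (drop k z)"
    by (metis append_take_drop_id u_def)
  have l: "length (take k z) = k" "length u = length w"
    using assms(3) by (auto simp: u_def)
  have "occurs_at v u (i + k)"
    using assms(1) l(1) by (subst (asm) z) (simp add: occurs_at_append)
  then have "u = w"
    using assms(2) l(2) by (rule occurs_at_unique)
  with z show "z = take k z @ w @ drop (length w) (drop k z)" by simp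
  show "length (take k z) = k" by fact
qed

lemma factors_appendD:
  assumes "a @ b \<in> factors v"
  shows "a \<in> factors v" "b \<in> factors v"
  using assms by (auto simp: factors_def occurs_at_append)

lemma factors_extend_right:
  assumes "y \<in> factors v"
  obtains c where "c \<in> range v" "y @ [c] \<in> factors v"
proof -
  obtain i where "occurs_at v y i" using assms by (auto simp: factors_def)
  then have "occurs_at v (y @ [v (i + length y)]) i"
    by (simp add: occurs_at_append occurs_at_singleton)
  then show thesis using that by (auto simp: factors_def)
qed

lemma set_factor:
  assumes "w \<in> factors v"
  shows "set w \<subseteq> range v"
proof -
  obtain i where "v [i \<rightarrow> i + length w] = w"
    using assms by (auto simp: factors_def occurs_at_def)
  then have "set w = v ` {i..<i + length w}" by (metis subsequence_def set_map set_upt)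
  then show ?thesis by auto
qed

lemma finite_factors_le:
  assumes "finite (range v)"
  shows "finite {w \<in> factors v. length w \<le> n}"
  by (rule finite_subset[OF _ finite_lists_length_le[OF assms, of n]]) (auto dest: set_factor)

section \<open>Right special factors\<close>

definition right_special :: "nat word \<Rightarrow> nat list \<Rightarrow> bool" where
  "right_special v z \<longleftrightarrow> z @ [0] \<in> factors v \<and> z @ [1] \<in> factors v"

lemma right_special_factor: "right_special v z \<Longrightarrow> z \<in> factors v"
  by (auto simp: right_special_def dest: factors_appendD)

lemma right_special_suffix: "right_special v (a @ z) \<Longrightarrow> right_special v z"
  by (auto simp: right_special_def dest: factors_appendD(2))

text \<open>Every factor can be continued by at least one letter, and over a binary alphabet a
  second continuation exists exactly when it is right special.\<close>

lemma card_right_extensions: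
  assumes "range v \<subseteq> {0, 1}" and "finite A" and "A \<subseteq> factors v"
  shows "card {y @ [c] | y c. y \<in> A \<and> y @ [c] \<in> factors v}
    = card A + card {y \<in> A. right_special v y}"
proof -
  \<comment> \<open>\<open>f\<close> prefers 0, so the second continuation of a right special word
    is always by 1; this keeps the two images below disjoint.\<close>
  define f :: "nat list \<Rightarrow> nat" where "f y = (if y @ [0] \<in> factors v then 0 else 1)" for y
  let ?R = "{y \<in> A. right_special v y}"
  have letter: "c = 0 \<or> c = 1" if "y @ [c] \<in> factors v" for y c
    using set_factor[OF that] assms(1) by auto
  have f: "y @ [f y] \<in> factors v" if "y \<in> A" for y
  proof -
    have "y \<in> factors v" using that assms(3) by auto
    then obtain c where "y @ [c] \<in> factors v" by (rule factors_extend_right)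
    then show ?thesis using letter[of y c] by (auto simp: f_def)
  qed
  have "{y @ [c] | y c. y \<in> A \<and> y @ [c] \<in> factors v}
    = (\<lambda>y. y @ [f y]) ` A \<union> (\<lambda>y. y @ [1]) ` ?R" (is "?E = ?F \<union> ?G")
  proof (intro equalityI subsetI)
    fix z assume "z \<in> ?E"
    then obtain y c where z: "z = y @ [c]" "y \<in> A" "y @ [c] \<in> factors v" by auto
    show "z \<in> ?F \<union> ?G"
    proof (cases "c = f y")
      case False
      then have "c = 1" "y @ [0] \<in> factors v"
        using letter[OF z(3)] z(3) by (auto simp: f_def split: if_splits)
      then show ?thesis using z by (auto simp: right_special_def)
    qed (use z in auto)
  qed (use f in \<open>auto simp: right_special_def\<close>)
  moreover have "?F \<inter> ?G = {}"
    by (auto simp: f_def right_special_def)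
  moreover have "card ?F = card A" "card ?G = card ?R"
    by (auto intro!: card_image inj_onI)
  ultimately show ?thesis
    using assms(2) by (simp add: card_Un_disjoint)
qed

text \<open>From \<open>i\<close> on the sequence has period \<open>j - i\<close>, so an occurrence
  at or beyond \<open>j\<close> can be moved left by one period. Hence each factor occurs at one of
  the \<open>j\<close> positions below \<open>j\<close>.\<close>

lemma not_eventually_periodic:
  assumes "i < j" and "\<And>k. v (i + k) = v (j + k)"
  shows "factor_complexity v n \<le> j"
proof -
  have early: "\<exists>a<j. occurs_at v w a" if "occurs_at v w a" for w a
    using that
  proof (induction a rule: less_induct)
    case (less a)
    show ?case
    proof (cases "a < j")
      case False
      have "v (a - (j - i) + k) = v (a + k)" for k
      proof -
        have "a - (j - i) + k = i + (a - j + k)" "a + k = j + (a - j + k)"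
          using False assms(1) by linarith+
        then show ?thesis using assms(2)[of "a - j + k"] by metis
      qed
      then have "occurs_at v w (a - (j - i))"
        using less.prems unfolding occurs_at_iff_nth by metis
      moreover have "a - (j - i) < a" using False assms(1) by auto
      ultimately show ?thesis using less.IH by blast
    qed (use less.prems in auto)
  qed
  have "{w \<in> factors v. length w = n} \<subseteq> (\<lambda>a. v [a \<rightarrow> a + n]) ` {..<j}"
  proof
    fix w assume "w \<in> {w \<in> factors v. length w = n}"
    then have n: "length w = n" and "\<exists>a. occurs_at v w a" by (simp_all add: factors_def)
    then obtain a where "a < j" "occurs_at v w a" using early by blast
    then show "w \<in> (\<lambda>a. v [a \<rightarrow> a + n]) ` {..<j}"
      using n by (intro image_eqI[of _ _ a]) (simp_all add: occurs_at_def)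
  qed
  then have "card {w \<in> factors v. length w = n} \<le> card {..<j}"
    by (rule surj_card_le[rotated]) simp
  then show ?thesis by (simp add: factor_complexity_def)
qed

section \<open>The tree of extensions up to the next occurrence\<close>

text \<open>The inner nodes of the tree with root \<open>x\<close>: the next occurrence of
  \<open>x\<close> is not yet complete.\<close>

definition single_occ :: "nat word \<Rightarrow> nat list \<Rightarrow> nat list set" where
  "single_occ v x = {z \<in> factors v. (\<exists>b. z = x @ b) \<and> (\<forall>a b. z = a @ x @ b \<longrightarrow> a = [])}"

text \<open>The leaves of the tree. Two separate conditions place \<open>x\<close> at the beginning
  and at the end, because these two occurrences may overlap.\<close>

definition complete_returns :: "nat word \<Rightarrow> nat list \<Rightarrow> nat list set" where
  "complete_returns v x = {z \<in> factors v. (\<exists>b. z = x @ b) \<and> (\<exists>r. r \<noteq> [] \<and> z = r @ x) \<and>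
     (\<forall>a b. z = a @ x @ b \<longrightarrow> a = [] \<or> b = [])}"

lemma single_occ_factor: "z \<in> single_occ v x \<Longrightarrow> z \<in> factors v"
  by (simp add: single_occ_def)

lemma single_occ_suffix: "u @ z \<in> single_occ v x \<Longrightarrow> z = x @ b \<Longrightarrow> u = []"
  by (auto simp: single_occ_def)

lemma single_occ_length: "z \<in> single_occ v x \<Longrightarrow> length x \<le> length z"
  by (auto simp: single_occ_def)

lemma complete_returns_length: "z \<in> complete_returns v x \<Longrightarrow> length x < length z"
  by (auto simp: complete_returns_def)

lemma single_occ_complete_returns_disjoint: "single_occ v x \<inter> complete_returns v x = {}"
  by (force simp: single_occ_def complete_returns_def)

text \<open>A new occurrence of \<open>x\<close> in \<open>y @ [c]\<close> must end at the letter
  \<open>c\<close>, since otherwise it would already lie in \<open>y\<close>. So a child of an inner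
  node is an inner node or a leaf.\<close>

lemma single_occ_extend:
  "y \<in> single_occ v x \<Longrightarrow> y @ [c] \<in> factors v \<Longrightarrow> y @ [c] \<in> single_occ v x \<union> complete_returns v x"
proof -
  assume y: "y \<in> single_occ v x" and f: "y @ [c] \<in> factors v"
  have last: "b = []" if "y @ [c] = a @ x @ b" "a \<noteq> []" for a b
  proof (cases b rule: rev_cases)
    case (snoc b' d)
    then have "y = a @ x @ b'" using that(1) by simp
    with y that(2) show ?thesis by (auto simp: single_occ_def)
  qed
  obtain b where b: "y = x @ b" using y by (auto simp: single_occ_def)
  show ?thesis
  proof (cases "\<forall>a b. y @ [c] = a @ x @ b \<longrightarrow> a = []")
    case True
    moreover have "\<exists>b. y @ [c] = x @ b" using b by simp
    ultimately have "y @ [c] \<in> single_occ v x"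
      using f unfolding single_occ_def by blast
    then show ?thesis by blast
  next
    case False
    then obtain a b' where ab: "y @ [c] = a @ x @ b'" "a \<noteq> []" by blast
    have "b' = []" using last[OF ab] .
    then have "\<exists>r. r \<noteq> [] \<and> y @ [c] = r @ x" using ab by auto
    moreover have "\<exists>b. y @ [c] = x @ b" using b by simp
    moreover have "\<forall>a b. y @ [c] = a @ x @ b \<longrightarrow> a = [] \<or> b = []"
      using last by blast
    ultimately have "y @ [c] \<in> complete_returns v x"
      using f unfolding complete_returns_def by blast
    then show ?thesis by blast
  qed
qed

lemma single_occ_butlast:
  assumes "y @ [c] \<in> single_occ v x \<union> complete_returns v x" and "length x \<le> length y"
  shows "y \<in> single_occ v x"
proof -
  have f: "y \<in> factors v"
    using assms(1) by (auto simp: single_occ_def complete_returns_def dest: factors_appendD)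
  obtain b where b: "y @ [c] = x @ b"
    using assms(1) by (auto simp: single_occ_def complete_returns_def)
  then have "y = x @ butlast b"
    using assms(2) by (cases b rule: rev_cases) auto
  moreover have "a = []" if "y = a @ x @ b'" for a b'
  proof -
    have "y @ [c] = a @ x @ (b' @ [c])" using that by simp
    then show ?thesis using assms(1) unfolding single_occ_def complete_returns_def by blast
  qed
  ultimately show ?thesis using f unfolding single_occ_def by blast
qed

text \<open>Cut the tree at level \<open>n\<close>; the left side counts the leaves of the finite
  tree that remains. A right special inner node has two children and any other inner node one, so
  each branching below level \<open>n\<close> adds one leaf to the initial single one.\<close>

lemma tree_count:
  assumes bin: "range v \<subseteq> {0, 1}" and x: "x \<in> factors v" and n: "length x \<le> n"
  shows "card {z \<in> single_occ v x. length z = n} + card {z \<in> complete_returns v x. length z \<le> n}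
    = 1 + card {z \<in> single_occ v x. right_special v z \<and> length z < n}"
  using n
proof (induction n rule: dec_induct)
  case base
  have "x \<in> single_occ v x"
    using x by (auto simp: single_occ_def dest: arg_cong[of _ _ length])
  then have "{z \<in> single_occ v x. length z = length x} = {x}"
    by (auto simp: single_occ_def)
  moreover have "{z \<in> complete_returns v x. length z \<le> length x} = {}"
    by (auto dest: complete_returns_length)
  moreover have "{z \<in> single_occ v x. right_special v z \<and> length z < length x} = {}"
    by (auto dest: single_occ_length)
  ultimately show ?case by (simp only: card.empty card.insert) simp
next
  case (step n)
  let ?S = "\<lambda>n. {z \<in> single_occ v x. length z = n}"
  let ?C = "{z \<in> complete_returns v x. length z = Suc n}"
  let ?R = "{y \<in> ?S n. right_special v y}"
  have "finite (range v)" using bin by (rule finite_subset) simp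
  note fin = finite_factors_le[OF this]
  have finS: "finite (?S k)" for k
    by (rule finite_subset[OF _ fin[of k]]) (auto simp: single_occ_def)
  have finC: "finite {z \<in> complete_returns v x. length z \<le> k}" for k
    by (rule finite_subset[OF _ fin[of k]]) (auto simp: complete_returns_def)
  have finC': "finite ?C"
    by (rule finite_subset[OF _ finC[of "Suc n"]]) auto
  have finR: "finite {z \<in> single_occ v x. right_special v z \<and> length z < k}" for k
    by (rule finite_subset[OF _ fin[of k]]) (auto simp: single_occ_def)
  \<comment> \<open>All nodes on level \<open>Suc n\<close> are children of inner nodes on level
    \<open>n\<close>, so counting right extensions counts the new level.\<close>
  have "{y @ [c] | y c. y \<in> ?S n \<and> y @ [c] \<in> factors v} = ?S (Suc n) \<union> ?C" (is "?E = _")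
  proof (intro equalityI subsetI)
    fix z assume "z \<in> ?E"
    then show "z \<in> ?S (Suc n) \<union> ?C" using single_occ_extend by fastforce
  next
    fix z assume z: "z \<in> ?S (Suc n) \<union> ?C"
    then obtain y c where yc: "z = y @ [c]" by (cases z rule: rev_cases) auto
    then have "y \<in> single_occ v x"
      using z step.hyps by (intro single_occ_butlast[of y c]) auto
    moreover have "z \<in> factors v"
      using z by (auto simp: single_occ_def complete_returns_def)
    ultimately show "z \<in> ?E" using z yc by auto
  qed
  moreover have "?S n \<subseteq> factors v" by (auto simp: single_occ_factor)
  ultimately have "card (?S (Suc n) \<union> ?C) = card (?S n) + card ?R"
    using card_right_extensions[OF bin finS[of n]] by simp
  moreover have "card (?S (Suc n) \<union> ?C) = card (?S (Suc n)) + card ?C"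
    using single_occ_complete_returns_disjoint[of v x] by (intro card_Un_disjoint finS finC') auto
  ultimately have "card (?S (Suc n)) + card ?C = card (?S n) + card ?R" by simp
  moreover have "card {z \<in> complete_returns v x. length z \<le> Suc n}
      = card {z \<in> complete_returns v x. length z \<le> n} + card ?C"
    by (subst card_Un_disjoint[symmetric]) (auto simp: finC finC' intro!: arg_cong[of _ _ card])
  moreover have "card {z \<in> single_occ v x. right_special v z \<and> length z < Suc n}
      = card {z \<in> single_occ v x. right_special v z \<and> length z < n} + card ?R"
    by (subst card_Un_disjoint[symmetric]) (auto simp: finR finS intro: finite_subset[OF _ finS[of n]] intro!: arg_cong[of _ _ card])
  ultimately show ?case using step.IH by linarith
qed

section \<open>Return words as the leaves of the tree\<close>

lemma consecutive_complete_return: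
  assumes "consecutive_occurrences v x i j"
  shows "v [i \<rightarrow> j] @ x \<in> complete_returns v x"
proof -
  let ?z = "v [i \<rightarrow> j] @ x"
  have ij: "i < j" "occurs_at v x i" "occurs_at v x j"
    and between: "\<And>k. i < k \<Longrightarrow> k < j \<Longrightarrow> \<not> occurs_at v x k"
    using assms by (auto simp: consecutive_occurrences_def)
  have z: "occurs_at v ?z i" using ij by (simp add: occurs_at_append)
  \<comment> \<open>Offset 0 gives \<open>x\<close> as a prefix of \<open>?z\<close> even if the two
    occurrences of \<open>x\<close> overlap.\<close>
  obtain a b where "?z = a @ x @ b" "length a = 0"
    by (rule occurs_at_inside[OF z, of x 0]) (use ij in auto)
  then have "?z = x @ b" by simp
  moreover have "v [i \<rightarrow> j] \<noteq> []"
    using ij(1) by (metis length_0_conv subsequence_length zero_less_diff less_numeral_extra(3))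
  moreover have "a = [] \<or> b = []" if "?z = a @ x @ b" for a b
  proof (rule ccontr)
    assume "\<not> ?thesis"
    moreover have "j - i = length a + length b"
      using arg_cong[OF that, of length] by (simp del: append_assoc)
    ultimately have "length a > 0" "length b > 0" "j = i + length a + length b"
      using ij(1) by auto
    then have "i < i + length a" "i + length a < j" by simp_all
    moreover have "occurs_at v x (i + length a)"
      using z unfolding that by (simp add: occurs_at_append)
    ultimately show False using between by blast
  qed
  ultimately show ?thesis using z unfolding complete_returns_def factors_def by blast
qed

text \<open>At any position where a leaf \<open>r @ x\<close> occurs, its first and last
  \<open>x\<close> are consecutive occurrences, since one between them would be an inner occurrence
  in the leaf.\<close>

lemma complete_returns_eq: "complete_returns v x = (\<lambda>r. r @ x) ` return_words v x"
proof (intro equalityI subsetI)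
  fix z assume "z \<in> (\<lambda>r. r @ x) ` return_words v x"
  then show "z \<in> complete_returns v x"
    by (auto simp: return_words_def intro: consecutive_complete_return)
next
  fix z assume z: "z \<in> complete_returns v x"
  then obtain r b i where r: "z = r @ x" "r \<noteq> []" and b: "z = x @ b" and i: "occurs_at v z i"
    by (auto simp: complete_returns_def factors_def)
  have "occurs_at v r i" "occurs_at v x (i + length r)"
    using i unfolding r(1) by (simp_all add: occurs_at_append)
  moreover have "occurs_at v x i"
    using i unfolding b by (simp add: occurs_at_append)
  moreover have False if k: "i < k" "k < i + length r" "occurs_at v x k" for k
  proof -
    obtain a b' where ab: "z = a @ x @ b'" "length a = k - i"
      by (rule occurs_at_inside[OF i, of x "k - i"]) (use k r(1) in auto)
    then have "a \<noteq> []" using k by auto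
    moreover have "b' \<noteq> []"
      using arg_cong[OF ab(1), of length] r(1) ab(2) k by auto
    ultimately show False using z ab(1) unfolding complete_returns_def by blast
  qed
  ultimately have "consecutive_occurrences v x i (i + length r)" "r = v [i \<rightarrow> i + length r]"
    using r(2) by (auto simp: consecutive_occurrences_def occurs_at_def)
  then have "r \<in> return_words v x" unfolding return_words_def by blast
  then show "z \<in> (\<lambda>r. r @ x) ` return_words v x" using r(1) by blast
qed

text \<open>Removes the cut from \<open>tree_count\<close>: finitely many branchings bound the
  number of leaves, and recurrence of \<open>x\<close> closes every branch, so the whole tree is
  finite.\<close>

lemma card_return_words_tree:
  assumes bin: "range v \<subseteq> {0, 1}" and x: "x \<in> factors v"
    and rec: "\<And>i. occurs_at v x i \<Longrightarrow> \<exists>j>i. occurs_at v x j"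
    and fin: "finite {z \<in> single_occ v x. right_special v z}"
  shows "card (return_words v x) = 1 + card {z \<in> single_occ v x. right_special v z}" (is "_ = 1 + card ?B")
proof -
  let ?C = "complete_returns v x"
  \<comment> \<open>A finite set of leaves lies below some level, where \<open>tree_count\<close>
    bounds it independently of that level.\<close>
  have bound: "card F \<le> 1 + card ?B" if F: "F \<subseteq> ?C" "finite F" for F
  proof -
    define n where "n = Max (insert (length x) (length ` F))"
    have n: "length x \<le> n" "\<And>z. z \<in> F \<Longrightarrow> length z \<le> n"
      using F(2) by (auto simp: n_def)
    have "finite (range v)" using bin by (rule finite_subset) simp
    then have "finite {z \<in> ?C. length z \<le> n}"
      by (rule finite_subset[OF _ finite_factors_le[of v n], rotated]) (auto simp: complete_returns_def)
    then have "card F \<le> card {z \<in> ?C. length z \<le> n}"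
      using F n by (intro card_mono) auto
    also have "\<dots> \<le> 1 + card {z \<in> single_occ v x. right_special v z \<and> length z < n}"
      using tree_count[OF bin x n(1)] by linarith
    also have "\<dots> \<le> 1 + card ?B"
      using fin by (auto intro!: card_mono)
    finally show ?thesis .
  qed
  have finC: "finite ?C"
  proof (rule ccontr)
    assume "\<not> finite ?C"
    then obtain F where "finite F" "card F = Suc (1 + card ?B)" "F \<subseteq> ?C"
      using infinite_arbitrarily_large by blast
    then show False using bound[of F] by simp
  qed
  \<comment> \<open>A level beyond all leaves and branching nodes; the \<open>Suc\<close> supplies
    the strict inequality that \<open>tree_count\<close> asks of branching nodes.\<close>
  define n where "n = Suc (Max (insert (length x) (length ` (?C \<union> ?B))))"
  have n: "length x \<le> n" "\<And>z. z \<in> ?C \<Longrightarrow> length z \<le> n" "\<And>z. z \<in> ?B \<Longrightarrow> length z < n"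
    using finC fin by (auto simp: n_def less_Suc_eq_le le_SucI)
  \<comment> \<open>Where such a \<open>z\<close> occurs, the next occurrence of \<open>x\<close>
    completes a leaf of length at most \<open>n\<close>, so this second \<open>x\<close> fits inside
    \<open>z\<close>.\<close>
  have "False" if z: "z \<in> single_occ v x" "length z = n" for z
  proof -
    obtain i where i: "occurs_at v z i" using z(1) by (auto simp: single_occ_def factors_def)
    then have ix: "occurs_at v x i" using z(1) by (auto simp: single_occ_def occurs_at_append)
    define j where "j = (LEAST j. i < j \<and> occurs_at v x j)"
    have j: "i < j \<and> occurs_at v x j"
      unfolding j_def using rec[OF ix] by (rule LeastI_ex)
    have "\<not> occurs_at v x k" if "i < k" "k < j" for k
      using not_less_Least[of k "\<lambda>j. i < j \<and> occurs_at v x j"] that by (simp flip: j_def)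
    then have "consecutive_occurrences v x i j"
      using j ix by (simp add: consecutive_occurrences_def)
    then have "v [i \<rightarrow> j] @ x \<in> ?C" by (rule consecutive_complete_return)
    from n(2)[OF this] have le: "j - i + length x \<le> length z" using z(2) by simp
    obtain a b where "z = a @ x @ b" "length a = j - i"
      by (rule occurs_at_inside[OF i, of x "j - i"]) (use j le in auto)
    then show False using z(1) j by (auto simp: single_occ_def)
  qed
  then have "{z \<in> single_occ v x. length z = n} = {}" by blast
  then have "card {z \<in> single_occ v x. length z = n} = 0" by (simp only: card.empty)
  moreover have "{z \<in> ?C. length z \<le> n} = ?C"
    "{z \<in> single_occ v x. right_special v z \<and> length z < n} = ?B"
    using n(2,3) by blast+
  ultimately have "card ?C = 1 + card ?B"
    using tree_count[OF bin x n(1)] by (simp only: add_0)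
  moreover have "card ?C = card (return_words v x)"
    unfolding complete_returns_eq by (intro card_image inj_onI) simp
  ultimately show ?thesis by simp
qed

section \<open>Complementary symmetric Rote sequences\<close>

lemma exchange_exchange [simp]: "map exchange (map exchange w) = w"
  by (induction w) (auto simp: exchange_def)

lemma cs_Rote_exchange:
  assumes "cs_Rote v"
  shows "map exchange w \<in> factors v \<longleftrightarrow> w \<in> factors v"
  using assms by (metis cs_Rote_def exchange_exchange)

lemma exchange_factor_neq:
  assumes "cs_Rote v" "w \<in> factors v" "w \<noteq> []"
  shows "map exchange w \<noteq> w"
proof -
  have "hd w \<in> {0, 1}"
    using set_factor[OF assms(2)] assms(1) hd_in_set[OF assms(3)] unfolding cs_Rote_def by blast
  then have "hd (map exchange w) \<noteq> hd w"
    using assms(3) by (auto simp: hd_map exchange_def)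
  then show ?thesis by metis
qed

text \<open>The complement of the prefix occurs away from 0, so some letter precedes it. Exchanging
  this longer factor yields a factor in which the prefix itself is preceded by a letter.\<close>

lemma cs_Rote_prefix_recurs:
  assumes "cs_Rote v" "n > 0"
  shows "\<exists>i>0. occurs_at v (v [0 \<rightarrow> n]) i"
proof -
  let ?p = "v [0 \<rightarrow> n]"
  have p: "?p \<in> factors v" "?p \<noteq> []"
    using assms(2) by (auto simp: factors_def intro: occurs_at_subsequence dest: arg_cong[of _ _ length])
  then obtain i where i: "occurs_at v (map exchange ?p) i"
    using cs_Rote_exchange[OF assms(1), of ?p] by (auto simp: factors_def)
  have "i \<noteq> 0"
    using exchange_factor_neq[OF assms(1) p] i occurs_at_unique[of v "map exchange ?p" 0 ?p]
    by (metis length_map occurs_at_subsequence)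
  then obtain k where k: "i = Suc k" by (cases i) auto
  have "occurs_at v ([v k] @ map exchange ?p) k"
    using i k by (simp only: occurs_at_append occurs_at_singleton) simp
  then have "[v k] @ map exchange ?p \<in> factors v" by (auto simp: factors_def)
  then have "map exchange ([v k] @ map exchange ?p) \<in> factors v"
    using cs_Rote_exchange[OF assms(1)] by blast
  then have "[exchange (v k)] @ ?p \<in> factors v"
    by (simp only: map_append exchange_exchange list.map)
  then obtain m where "occurs_at v ([exchange (v k)] @ ?p) m" by (auto simp: factors_def)
  then have "occurs_at v ?p (Suc m)" by (simp only: occurs_at_append) simp
  then show ?thesis by blast
qed

text \<open>The occurrence at \<open>i\<close> lies in a prefix of \<open>v\<close>, and it moves
  along when that prefix recurs.\<close>

lemma cs_Rote_recurrent:
  assumes "cs_Rote v" "occurs_at v y i"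
  shows "\<exists>j>i. occurs_at v y j"
proof (cases "y = []")
  case False
  obtain k where k: "k > 0" "occurs_at v (v [0 \<rightarrow> i + length y]) k"
    using cs_Rote_prefix_recurs[OF assms(1), of "i + length y"] False by auto
  obtain a b where ab: "v [0 \<rightarrow> i + length y] = a @ y @ b" "length a = i"
    by (rule occurs_at_inside[of v "v [0 \<rightarrow> i + length y]" 0 y i]) (use assms(2) in auto)
  then have "occurs_at v y (k + i)"
    using k(2) by (simp add: occurs_at_append)
  then show ?thesis using k(1) by (intro exI[of _ "k + i"]) simp
qed auto

text \<open>Otherwise every continuation of \<open>y\<close> is forced, so \<open>v\<close> reads
  the same from two occurrences of \<open>y\<close> on and is eventually periodic.\<close>

lemma cs_Rote_prefix_of_right_special:
  assumes "cs_Rote v" "y \<in> factors v"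
  shows "\<exists>b. right_special v (y @ b)"
proof (rule ccontr)
  assume no: "\<not> ?thesis"
  obtain i where i: "occurs_at v y i" using assms(2) by (auto simp: factors_def)
  obtain j where j: "i < j" "occurs_at v y j" using cs_Rote_recurrent[OF assms(1) i] by auto
  have bin: "v k = 0 \<or> v k = 1" for k using assms(1) by (auto simp: cs_Rote_def)
  have "\<exists>b. length b = k \<and> occurs_at v (y @ b) i \<and> occurs_at v (y @ b) j" for k
  proof (induction k)
    case 0
    then show ?case using i j by simp
  next
    case (Suc k)
    then obtain b where b: "length b = k" "occurs_at v (y @ b) i" "occurs_at v (y @ b) j" by auto
    let ?c = "v (i + length (y @ b))" and ?d = "v (j + length (y @ b))"
    have oc: "occurs_at v ((y @ b) @ [?c]) i" "occurs_at v ((y @ b) @ [?d]) j"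
      using b(2,3) by (simp_all only: occurs_at_append[of v "y @ b"] occurs_at_singleton simp_thms)
    then have "(y @ b) @ [?c] \<in> factors v" "(y @ b) @ [?d] \<in> factors v"
      unfolding factors_def by blast+
    then have "?c = ?d"
      using no bin[of "i + length (y @ b)"] bin[of "j + length (y @ b)"]
      unfolding right_special_def by metis
    then have "occurs_at v (y @ b @ [?c]) i \<and> occurs_at v (y @ b @ [?c]) j"
      using oc by simp
    then show ?case using b(1) by (intro exI[of _ "b @ [?c]"]) simp
  qed
  then have "v (i + k) = v (j + k)" for k
  proof -
    \<comment> \<open>Length \<open>Suc k\<close> puts offset \<open>k\<close> inside
      \<open>y @ b\<close> even if \<open>y\<close> is empty.\<close>
    obtain b where b: "length b = Suc k" "occurs_at v (y @ b) i" "occurs_at v (y @ b) j"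
      using \<open>\<And>k. \<exists>b. length b = k \<and> _ b\<close> by blast
    then have "k < length (y @ b)" by simp
    then show ?thesis using b(2,3) unfolding occurs_at_iff_nth by metis
  qed
  \<comment> \<open>Length \<open>j\<close> already suffices for the contradiction, as
    \<open>2 * j\<close> exceeds \<open>j\<close>.\<close>
  then have "factor_complexity v j \<le> j"
    using j(1) by (rule not_eventually_periodic[rotated])
  moreover have "factor_complexity v j = 2 * j"
    using assms(1) j(1) by (auto simp: cs_Rote_def)
  ultimately show False using j(1) by simp
qed

section \<open>The two right special factors of each length\<close>

lemma right_special_exchange:
  assumes "cs_Rote v" "right_special v z"
  shows "right_special v (map exchange z)"
proof -
  have "map exchange (z @ [c]) \<in> factors v" if "z @ [c] \<in> factors v" for c
    using cs_Rote_exchange[OF assms(1)] that by blast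
  from this[of 0] this[of 1] show ?thesis
    using assms(2) by (auto simp: right_special_def exchange_def)
qed

text \<open>The number of right special factors of length \<open>n\<close> is the increment of the
  complexity, \<open>2 * Suc n - 2 * n\<close>.\<close>

lemma cs_Rote_card_right_special:
  assumes "cs_Rote v" "n > 0"
  shows "card {z. right_special v z \<and> length z = n} = 2"
proof -
  have bin: "range v \<subseteq> {0, 1}" using assms(1) by (simp add: cs_Rote_def)
  let ?L = "\<lambda>n. {w \<in> factors v. length w = n}"
  have card: "card (?L k) = 2 * k" if "k > 0" for k
    using assms(1) that by (auto simp: cs_Rote_def factor_complexity_def)
  have "finite (?L n)" using card[OF assms(2)] assms(2) by (intro card_ge_0_finite) simp
  then have "card {y @ [c] | y c. y \<in> ?L n \<and> y @ [c] \<in> factors v}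
      = card (?L n) + card {y \<in> ?L n. right_special v y}"
    by (intro card_right_extensions[OF bin]) auto
  moreover have "{y @ [c] | y c. y \<in> ?L n \<and> y @ [c] \<in> factors v} = ?L (Suc n)" (is "?E = _")
  proof (intro equalityI subsetI)
    fix z assume "z \<in> ?L (Suc n)"
    then show "z \<in> ?E" by (cases z rule: rev_cases) (auto dest: factors_appendD)
  qed auto
  moreover have "{y \<in> ?L n. right_special v y} = {z. right_special v z \<and> length z = n}"
    by (auto dest: right_special_factor)
  ultimately show ?thesis using card[of n] card[of "Suc n"] assms(2) by simp
qed

lemma cs_Rote_right_special_cases:
  assumes "cs_Rote v" "right_special v q" "right_special v z" "length z = length q" "q \<noteq> []"
  shows "z = q \<or> z = map exchange q"
proof -
  let ?R = "{z. right_special v z \<and> length z = length q}"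
  have two: "card ?R = 2" using cs_Rote_card_right_special[OF assms(1)] assms(5) by simp
  have "{q, map exchange q} = ?R"
  proof (rule card_subset_eq)
    show "finite ?R" using two by (intro card_ge_0_finite) simp
    show "{q, map exchange q} \<subseteq> ?R"
      using assms(1,2) by (auto intro: right_special_exchange)
    show "card {q, map exchange q} = card ?R"
      using exchange_factor_neq[OF assms(1) right_special_factor[OF assms(2)] assms(5)] two by auto
  qed
  then show ?thesis using assms(3,4) by auto
qed

section \<open>Locating the branching nodes\<close>

lemma last_occurrence:
  assumes "q = a @ x @ b" "q \<in> factors v"
  shows "\<exists>a z. q = a @ z \<and> z \<in> single_occ v x"
  using assms
\<comment> \<open>As long as \<open>x @ b\<close> contains a later \<open>x\<close>, pass to that
  one; the remaining tail \<open>b\<close> gets shorter.\<close>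
proof (induction "length b" arbitrary: a b rule: less_induct)
  case less
  show ?case
  proof (cases "x @ b \<in> single_occ v x")
    case False
    moreover have "x @ b \<in> factors v" using less.prems by (auto dest: factors_appendD)
    ultimately obtain a' b' where ab: "x @ b = a' @ x @ b'" "a' \<noteq> []"
      by (auto simp: single_occ_def)
    have "length x + length b = length a' + length x + length b'"
      using arg_cong[OF ab(1), of length] by simp
    moreover have "length a' > 0" using ab(2) by simp
    ultimately have "length b' < length b" by linarith
    then show ?thesis using less.hyps[of b' "a @ a'"] less.prems ab by simp
  qed (use less.prems in auto)
qed

text \<open>One of two suffixes of a word is a suffix of the other; both begin with
  \<open>x\<close>, so the longer one would contain a second occurrence.\<close>

lemma single_occ_suffix_unique:
  assumes "a @ z = a' @ z'" "z \<in> single_occ v x" "z' \<in> single_occ v x"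
  shows "z = z'"
proof -
  obtain b b' where b: "z = x @ b" "z' = x @ b'"
    using assms(2,3) by (auto simp: single_occ_def)
  obtain u where "u @ z = z' \<or> u @ z' = z"
    using assms(1) unfolding append_eq_append_conv2 by metis
  then show ?thesis
    using single_occ_suffix[OF _ b(1), of u v] single_occ_suffix[OF _ b(2), of u v] assms(2,3)
    by (metis append_Nil)
qed

lemma cs_Rote_card_branching:
  assumes R: "cs_Rote v" and x: "x \<in> factors v" "x \<noteq> []"
  shows "card {z \<in> single_occ v x. right_special v z} = 2"
proof -
  obtain i where i: "occurs_at v x i" using x by (auto simp: factors_def)
  obtain k where k: "occurs_at v (map exchange x) k"
    using x cs_Rote_exchange[OF R, of x] by (auto simp: factors_def)
  \<comment> \<open>Long enough to cover the occurrence of \<open>x\<close> at \<open>i\<close> and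
    that of its complement at \<open>k\<close>.\<close>
  define p where "p = v [0 \<rightarrow> i + k + length x]"
  have p: "occurs_at v p 0" by (simp add: p_def)
  obtain a1 b1 where 1: "p = a1 @ x @ b1"
    by (rule occurs_at_inside[OF p, of x i]) (use i in \<open>auto simp: p_def\<close>)
  obtain a2 b2 where 2: "p = a2 @ map exchange x @ b2"
    by (rule occurs_at_inside[OF p, of "map exchange x" k]) (use k in \<open>auto simp: p_def\<close>)
  have "p \<in> factors v" using p by (auto simp: factors_def)
  then obtain b where q: "right_special v (p @ b)"
    using cs_Rote_prefix_of_right_special[OF R] by blast
  define q where "q = p @ b"
  define q' where "q' = map exchange q"
  have rs: "right_special v q" "right_special v q'"
    using q right_special_exchange[OF R q] by (simp_all only: q_def q'_def)
  have "q = a1 @ x @ (b1 @ b)" by (simp add: q_def 1)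
  then obtain c z where z: "q = c @ z" "z \<in> single_occ v x"
    using last_occurrence right_special_factor[OF rs(1)] by metis
  \<comment> \<open>The complement of \<open>x\<close> inside \<open>q\<close> turns into
    \<open>x\<close> inside \<open>q'\<close>, so \<open>q'\<close> also has a last occurrence of
    \<open>x\<close>.\<close>
  have "q' = map exchange a2 @ map exchange (map exchange x) @ map exchange (b2 @ b)"
    unfolding q'_def q_def 2 by (simp del: exchange_exchange)
  then have "q' = map exchange a2 @ x @ map exchange (b2 @ b)"
    by (simp only: exchange_exchange)
  then obtain c' z' where z': "q' = c' @ z'" "z' \<in> single_occ v x"
    using last_occurrence right_special_factor[OF rs(2)] by metis
  have ne: "z \<noteq> []" "q \<noteq> []" using z x(2) by (auto simp: single_occ_def)
  have "z \<noteq> z'"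
  proof
    assume "z = z'"
    \<comment> \<open>Nonempty suffixes of \<open>q\<close> and of its complement end in different
      letters.\<close>
    then have "last (map exchange q) = last q" using z z' ne(1) by (simp add: q'_def)
    then have "exchange (last q) = last q" using ne(2) by (simp add: last_map)
    moreover have "last q \<in> {0, 1}"
      using set_factor[OF right_special_factor[OF rs(1)]] R last_in_set[OF ne(2)]
      unfolding cs_Rote_def by blast
    ultimately show False by (auto simp: exchange_def)
  qed
  moreover have "{z \<in> single_occ v x. right_special v z} = {z, z'}"
  proof (intro equalityI subsetI)
    fix y assume "y \<in> {z, z'}"
    then show "y \<in> {z \<in> single_occ v x. right_special v z}"
      using z z' rs by (auto intro: right_special_suffix)
  next
    fix y assume "y \<in> {z \<in> single_occ v x. right_special v z}"
    then have y: "y \<in> single_occ v x" "right_special v y" by auto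
    have yne: "y \<noteq> []" using y x(2) by (auto simp: single_occ_def)
    show "y \<in> {z, z'}"
    proof (cases "length y \<le> length q")
      case True
      \<comment> \<open>The suffix of \<open>q\<close> of the length of \<open>y\<close> is right
        special, so \<open>y\<close> is that suffix or its complement, hence a suffix of
        \<open>q\<close> or of \<open>q'\<close>.\<close>
      define s where "s = drop (length q - length y) q"
      define t where "t = take (length q - length y) q"
      have ts: "q = t @ s" "length s = length y" using True by (auto simp: s_def t_def)
      then have "right_special v s" "s \<noteq> []" using right_special_suffix[of v t s] rs(1) yne by auto
      then have "y = s \<or> y = map exchange s"
        using cs_Rote_right_special_cases[OF R _ y(2), of s] ts(2) by simp
      then have "q = t @ y \<or> q' = map exchange t @ y"
        unfolding q'_def ts(1) by auto
      then have "t @ y = c @ z \<or> map exchange t @ y = c' @ z'" using z(1) z'(1) by auto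
      then have "y = z \<or> y = z'"
        using single_occ_suffix_unique[OF _ y(1) z(2)] single_occ_suffix_unique[OF _ y(1) z'(2)]
        by blast
      then show ?thesis by simp
    next
      case False
      \<comment> \<open>Now a suffix of \<open>y\<close> has the length of \<open>q\<close> and must
        be \<open>q\<close> or \<open>q'\<close>, so \<open>z\<close> or \<open>z'\<close> is a
        suffix of \<open>y\<close>.\<close>
      define s where "s = drop (length y - length q) y"
      define t where "t = take (length y - length q) y"
      have ts: "y = t @ s" "length s = length q" "t \<noteq> []" using False by (auto simp: s_def t_def)
      then have "right_special v s" using right_special_suffix[of v t s] y(2) by simp
      then have "s = q \<or> s = q'"
        using cs_Rote_right_special_cases[OF R rs(1), of s] ts(2) ne(2) by (simp add: q'_def)
      then have "(t @ c) @ z = [] @ y \<or> (t @ c') @ z' = [] @ y"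
        using ts(1) z(1) z'(1) by auto
      then have "y = z \<or> y = z'"
        using single_occ_suffix_unique[OF _ z(2) y(1)] single_occ_suffix_unique[OF _ z'(2) y(1)]
        by blast
      then show ?thesis by simp
    qed
  qed
  ultimately show ?thesis by simp
qed

theorem theorem3p1:
  fixes v :: "nat word" and x :: "nat list"
  assumes "cs_Rote v"
    and "x \<noteq> []"
    and "x = prefix (length x) v"
  shows "card (return_words v x) = 3"
proof -
  have bin: "range v \<subseteq> {0, 1}" using assms(1) by (simp add: cs_Rote_def)
  have "occurs_at v x 0" using assms(3) by (simp add: occurs_at_def)
  then have x: "x \<in> factors v" by (auto simp: factors_def)
  have two: "card {z \<in> single_occ v x. right_special v z} = 2"
    using cs_Rote_card_branching[OF assms(1) x assms(2)] .
  then have "finite {z \<in> single_occ v x. right_special v z}"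
    by (intro card_ge_0_finite) simp
  then show ?thesis
    using card_return_words_tree[OF bin x cs_Rote_recurrent[OF assms(1)]] two by simp
qed

end
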